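(* Let $\mathcal X,\mathcal Y$ be normed vector spaces, $T:\mathcal X\to\mathcal Y$ a bounded linear operator, $\mathcal D$ a subset of $\mathcal X$, and $W:\mathcal D\to\mathbb R$ a functional such that: (1) there exists $\gamma\ge0$ such that $W(x)\ge-\gamma$ for every $x\in\mathcal D$; (2) every $T$-$W$-bounded sequence in $\mathcal D$ contains a subsequence converging (in norm) to an element of $\mathcal D$. Let $J,J_n:\mathcal D\to\mathbb R$, $n=1,2,\dots$, be functionals such that $J$ is $T$-$W$-subsequentially lower semicontinuous and $\{J_n\}$ is $T$-$W$-coercive and $T$-$W$-uniformly consistent for $J$. Suppose further that $J$ has a unique global minimizer $\bar x\in\mathcal D$ and that each functional $J_n$ possesses a global minimizer $x_n$ on $\mathcal D$ (not necessarily unique). Then $x_n\to\bar x$ in norm.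
   Context: A sequence $\{x_n\}\subset\mathcal D$ is $T$-$W$-bounded if $\{\|Tx_n\|+W(x_n)\}$ is bounded in $\mathbb R$. $J$ is $T$-$W$-subsequentially lower semicontinuous if for every $T$-$W$-bounded sequence $\{x_n\}\subset\mathcal D$ converging in norm to some $x\in\mathcal D$ there is a subsequence $\{x_{n_j}\}$ with $J(x)\le\liminf_{j\to\infty}J(x_{n_j})$. $\{J_n\}$ is $T$-$W$-coercive if $\lim_{n\to\infty}J_n(x_n)=+\infty$ for every sequence $\{x_n\}\subset\mathcal D$ with $\lim_{n\to\infty}\left(\|Tx_n\|+W(x_n)\right)=+\infty$. $\{J_n\}$ is $T$-$W$-uniformly consistent for $J$ if for any $c>0$ and $\epsilon>0$ there exists $N=N(c,\epsilon)$ such that $|J_n(x)-J(x)|<\epsilon$ for every $n\ge N$ and every $x\in\mathcal D$ with $\|Tx\|+|W(x)|\le c$. *)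

theory Defs
  imports "HOL-Analysis.Analysis"
begin

text \<open>
  Functionals on a subset \<open>D\<close> of a normed space are represented by total functions;
  all notions below depend only on their values on \<open>D\<close>.
\<close>

definition TW_bounded ::
  "('a::real_normed_vector \<Rightarrow> 'b::real_normed_vector) \<Rightarrow> ('a \<Rightarrow> real) \<Rightarrow> 'a set \<Rightarrow> (nat \<Rightarrow> 'a) \<Rightarrow> bool"
  where "TW_bounded T W D x \<longleftrightarrow>
    range x \<subseteq> D \<and> bounded (range (\<lambda>n. norm (T (x n)) + W (x n)))"

text \<open>The limit inferior is taken in the extended reals, since it may be infinite.\<close>

definition TW_subseq_lsc ::
  "('a::real_normed_vector \<Rightarrow> 'b::real_normed_vector) \<Rightarrow> ('a \<Rightarrow> real) \<Rightarrow> 'a set \<Rightarrow> ('a \<Rightarrow> real) \<Rightarrow> bool"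
  where "TW_subseq_lsc T W D J \<longleftrightarrow>
    (\<forall>x l. TW_bounded T W D x \<and> l \<in> D \<and> x \<longlonglongrightarrow> l \<longrightarrow>
      (\<exists>r::nat \<Rightarrow> nat. strict_mono r \<and>
        ereal (J l) \<le> liminf (\<lambda>j. ereal (J (x (r j))))))"

text \<open>
  In the next two notions the family and the sequences are indexed by all natural numbers.
  The member with index \<open>0\<close> is irrelevant, as only large indices matter.
\<close>

definition TW_coercive ::
  "('a::real_normed_vector \<Rightarrow> 'b::real_normed_vector) \<Rightarrow> ('a \<Rightarrow> real) \<Rightarrow> 'a set \<Rightarrow> (nat \<Rightarrow> 'a \<Rightarrow> real) \<Rightarrow> bool"
  where "TW_coercive T W D Jn \<longleftrightarrow>
    (\<forall>x. range x \<subseteq> D \<and> filterlim (\<lambda>n. norm (T (x n)) + W (x n)) at_top sequentially \<longrightarrow>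
      filterlim (\<lambda>n. Jn n (x n)) at_top sequentially)"

definition TW_unif_consistent ::
  "('a::real_normed_vector \<Rightarrow> 'b::real_normed_vector) \<Rightarrow> ('a \<Rightarrow> real) \<Rightarrow> 'a set \<Rightarrow>
    (nat \<Rightarrow> 'a \<Rightarrow> real) \<Rightarrow> ('a \<Rightarrow> real) \<Rightarrow> bool"
  where "TW_unif_consistent T W D Jn J \<longleftrightarrow>
    (\<forall>c>0. \<forall>\<epsilon>>0. \<exists>N. \<forall>n\<ge>N. \<forall>x\<in>D.
      norm (T x) + \<bar>W x\<bar> \<le> c \<longrightarrow> \<bar>Jn n x - J x\<bar> < \<epsilon>)"

end

theory Submission
  imports Defs
begin

text \<open>
  Write \<open>g z = norm (T z) + W z\<close> for the gauge that measures \<open>T\<close>-\<open>W\<close>-boundedness. The proof is the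
  direct method of the calculus of variations, run along the minimizers \<open>x n\<close> of the functionals
  \<open>Jn n\<close>.

  Comparison with the fixed competitor \<open>xbar\<close> gives \<open>Jn n (x n) \<le> Jn n xbar\<close>, and the right-hand
  side tends to \<open>J xbar\<close> by consistency. Hence the values \<open>Jn n (x n)\<close> stay bounded above, and
  coercivity bounds \<open>g (x n)\<close>. Coercivity speaks of sequences whose gauge tends to infinity,
  whereas unboundedness of \<open>g (x n)\<close> yields only a subsequence with this behaviour; the lemma
  \<open>TW_coerciveD_uniform\<close> bridges this gap by turning coercivity into a statement about single points.

  As \<open>W\<close> is bounded below, a bound on the gauge bounds \<open>norm (T z) + \<bar>W z\<bar>\<close>, so consistency is
  uniform along the minimizers and the values \<open>J (x n)\<close> are eventually below \<open>J xbar + \<epsilon>\<close>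
  (\<open>minimizers_are_minimizing\<close>). By compactness, semicontinuity and uniqueness, a \<open>T\<close>-\<open>W\<close>-bounded
  sequence with this property has a subsequence converging to \<open>xbar\<close>
  (\<open>TW_bounded_minimizing_subseq\<close>). This applies to a tail of every subsequence of \<open>x\<close>, so the
  whole sequence converges.
\<close>

text \<open>
  If the claim fails for some \<open>M\<close>, there are indices \<open>r 0 < r 1 < \<dots>\<close> and points \<open>v k\<close> of gauge at least
  \<open>k\<close> with \<open>Jn (r k) (v k) \<le> M\<close>. Coercivity needs a point for every index, not only for those in the
  range of \<open>r\<close>; the remaining positions are filled with the same points \<open>v n\<close>, so that the gauge
  still tends to infinity while \<open>Jn n\<close> takes values at most \<open>M\<close> infinitely often.
\<close>

lemma TW_coerciveD_uniform:
  assumes "TW_coercive T W D Jn"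
  shows "\<exists>N. \<forall>n\<ge>N. \<forall>z\<in>D. real N \<le> norm (T z) + W z \<longrightarrow> M < Jn n z"
proof (rule ccontr)
  define g where "g z = norm (T z) + W z" for z
  define Q where "Q k n \<longleftrightarrow> (\<exists>z\<in>D. real k \<le> g z \<and> Jn n z \<le> M)" for k n
  assume "\<not> ?thesis"
  then have ex: "\<exists>n\<ge>N. Q N n" for N
    unfolding Q_def g_def by (meson not_less)
  have "\<exists>n>m. Q k n" for k m
  proof -
    obtain n where "n \<ge> Suc (max k m)" "Q (Suc (max k m)) n"
      using ex by blast
    then have "n > m" "Q k n"
      unfolding Q_def by force+
    then show ?thesis by blast
  qed
  then obtain r where Q: "\<And>k. Q k (r k)" and "\<And>k. r k < r (Suc k)"
    using dependent_nat_choice[of Q "\<lambda>_ m n. m < n"] by blast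
  then have r: "strict_mono r"
    by (simp add: strict_mono_Suc_iff)
  obtain v where v: "\<And>k. v k \<in> D" "\<And>k. real k \<le> g (v k)" "\<And>k. Jn (r k) (v k) \<le> M"
    using Q unfolding Q_def by metis
  define u where "u n = (if n \<in> range r then v (inv r n) else v n)" for n
  have ur: "u (r k) = v k" for k
    using r by (simp add: u_def strict_mono_imp_inj_on)
  have "real k \<le> g (u n)" if "n \<ge> r k" for n k
  proof (cases "n \<in> range r")
    case True
    then obtain j where j: "n = r j" by blast
    then have "k \<le> j" using that r by (simp add: strict_mono_less_eq)
    then show ?thesis using v(2)[of j] by (simp add: j ur)
  next
    case False
    have "k \<le> n" using that seq_suble[OF r, of k] by simp
    then show ?thesis using v(2)[of n] False by (simp add: u_def)
  qed
  then have "filterlim (\<lambda>n. g (u n)) at_top sequentially"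
    unfolding filterlim_at_top eventually_sequentially
    by (meson order_trans real_arch_simple)
  moreover have "range u \<subseteq> D" using v(1) by (auto simp: u_def)
  ultimately have "filterlim (\<lambda>n. Jn n (u n)) at_top sequentially"
    using assms unfolding TW_coercive_def g_def by blast
  then have "eventually (\<lambda>n. M < Jn n (u n)) sequentially"
    by (simp add: filterlim_at_top_dense)
  then obtain N where "\<And>n. n \<ge> N \<Longrightarrow> M < Jn n (u n)"
    by (auto simp: eventually_sequentially)
  from this[of "r N"] show False
    using v(3)[of N] seq_suble[OF r, of N] by (simp add: ur)
qed

lemma TW_unif_consistent_eventually:
  assumes "TW_unif_consistent T W D Jn J" "0 < \<epsilon>"
  shows "\<forall>\<^sub>F n in sequentially. \<forall>z\<in>D. norm (T z) + \<bar>W z\<bar> \<le> c \<longrightarrow> \<bar>Jn n z - J z\<bar> < \<epsilon>"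
proof -
  obtain N where "\<forall>n\<ge>N. \<forall>z\<in>D. norm (T z) + \<bar>W z\<bar> \<le> max c 1 \<longrightarrow> \<bar>Jn n z - J z\<bar> < \<epsilon>"
    using assms unfolding TW_unif_consistent_def by (metis less_max_iff_disj zero_less_one)
  then show ?thesis
    unfolding eventually_sequentially by (meson max.coboundedI1)
qed

corollary TW_unif_consistent_upper:
  assumes "TW_unif_consistent T W D Jn J" "z \<in> D" "0 < \<epsilon>"
  shows "\<forall>\<^sub>F n in sequentially. Jn n z < J z + \<epsilon>"
  using TW_unif_consistent_eventually[OF assms(1,3), of "norm (T z) + \<bar>W z\<bar>"]
  by eventually_elim (use assms(2) in fastforce)

text \<open>
  The competitor \<open>p\<close> eventually keeps \<open>Jn n (x n)\<close> below \<open>J p + 1\<close>, a level that coercivity forbids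
  at points of large gauge.
\<close>

lemma minimizers_gauge_bounded:
  assumes "TW_coercive T W D Jn" "TW_unif_consistent T W D Jn J" "p \<in> D"
    and min: "\<forall>\<^sub>F n in sequentially. x n \<in> D \<and> Jn n (x n) \<le> Jn n p"
  shows "\<exists>c. \<forall>\<^sub>F n in sequentially. norm (T (x n)) + W (x n) \<le> c"
proof -
  obtain N where N: "\<And>n z. n \<ge> N \<Longrightarrow> z \<in> D \<Longrightarrow> real N \<le> norm (T z) + W z \<Longrightarrow> J p + 1 < Jn n z"
    using TW_coerciveD_uniform[OF assms(1), of "J p + 1"] by blast
  have "\<forall>\<^sub>F n in sequentially. norm (T (x n)) + W (x n) \<le> real N"
    using min TW_unif_consistent_upper[OF assms(2,3), of 1, OF zero_less_one]
      eventually_ge_at_top[of N]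
    by eventually_elim (use N in fastforce)
  then show ?thesis ..
qed

text \<open>
  With the gauge bounded, consistency replaces \<open>Jn n\<close> by \<open>J\<close> at the moving point \<open>x n\<close> and
  at the fixed point \<open>p\<close>; each replacement costs \<open>\<epsilon> / 2\<close>.
\<close>

lemma minimizers_are_minimizing:
  assumes "TW_unif_consistent T W D Jn J" "p \<in> D"
    and W: "\<And>z. z \<in> D \<Longrightarrow> - \<gamma> \<le> W z"
    and min: "\<forall>\<^sub>F n in sequentially. x n \<in> D \<and> Jn n (x n) \<le> Jn n p"
    and bdd: "\<forall>\<^sub>F n in sequentially. norm (T (x n)) + W (x n) \<le> c"
    and "0 < \<epsilon>"
  shows "\<forall>\<^sub>F n in sequentially. J (x n) \<le> J p + \<epsilon>"
proof -
  have half: "0 < \<epsilon> / 2" using \<open>0 < \<epsilon>\<close> by simp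
  have abs_W: "\<bar>W z\<bar> \<le> W z + 2 * \<bar>\<gamma>\<bar>" if "z \<in> D" for z
    using W[OF that] by linarith
  show ?thesis
    using min bdd TW_unif_consistent_upper[OF assms(1,2) half]
      TW_unif_consistent_eventually[OF assms(1) half, of "c + 2 * \<bar>\<gamma>\<bar>"]
  proof eventually_elim
    case (elim n)
    then have "norm (T (x n)) + \<bar>W (x n)\<bar> \<le> c + 2 * \<bar>\<gamma>\<bar>"
      using abs_W[of "x n"] by linarith
    then have "\<bar>Jn n (x n) - J (x n)\<bar> < \<epsilon> / 2"
      using elim by blast
    then show ?case using elim by linarith
  qed
qed

text \<open>
  Compactness provides a limit point in \<open>D\<close>; semicontinuity makes it a minimizer of \<open>J\<close>, and
  uniqueness identifies it with \<open>p\<close>.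
\<close>

lemma TW_bounded_minimizing_subseq:
  assumes compact: "\<And>v. TW_bounded T W D v \<Longrightarrow>
      \<exists>l\<in>D. \<exists>r::nat \<Rightarrow> nat. strict_mono r \<and> (v \<circ> r) \<longlonglongrightarrow> l"
    and lsc: "TW_subseq_lsc T W D J"
    and unique: "\<And>z. z \<in> D \<Longrightarrow> J z \<le> J p \<Longrightarrow> z = p"
    and bdd: "TW_bounded T W D u"
    and minimizing: "\<And>\<epsilon>. 0 < \<epsilon> \<Longrightarrow> \<forall>\<^sub>F n in sequentially. J (u n) \<le> J p + \<epsilon>"
  shows "\<exists>s::nat \<Rightarrow> nat. strict_mono s \<and> (u \<circ> s) \<longlonglongrightarrow> p"
proof -
  obtain l s where l: "l \<in> D" and s: "strict_mono (s :: nat \<Rightarrow> nat)" and lim: "(u \<circ> s) \<longlonglongrightarrow> l"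
    using compact[OF bdd] by blast
  have "TW_bounded T W D (u \<circ> s)"
    using bdd unfolding TW_bounded_def by (auto elim!: bounded_subset)
  then obtain t where t: "strict_mono (t :: nat \<Rightarrow> nat)"
      and le: "ereal (J l) \<le> liminf (\<lambda>j. ereal (J ((u \<circ> s) (t j))))"
    using lsc l lim unfolding TW_subseq_lsc_def by blast
  have "J l \<le> J p + \<epsilon>" if "0 < \<epsilon>" for \<epsilon>
  proof -
    have "\<forall>\<^sub>F j in sequentially. J (u ((s \<circ> t) j)) \<le> J p + \<epsilon>"
      using eventually_subseq[OF strict_mono_o[OF s t] minimizing[OF that]] .
    then have "liminf (\<lambda>j. ereal (J ((u \<circ> s) (t j)))) \<le> liminf (\<lambda>j. ereal (J p + \<epsilon>))"
      by (intro Liminf_mono) simp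
    with le show ?thesis
      by (simp add: Liminf_const) (metis ereal_less_eq(3) order_trans plus_ereal.simps(1))
  qed
  then have "l = p" using unique[OF l] field_le_epsilon by blast
  with s lim show ?thesis by blast
qed

lemma LIMSEQ_if_subseqs_LIMSEQ:
  fixes x :: "nat \<Rightarrow> 'a::metric_space"
  assumes "\<And>r::nat \<Rightarrow> nat. strict_mono r \<Longrightarrow> \<exists>s::nat \<Rightarrow> nat. strict_mono s \<and> (x \<circ> r \<circ> s) \<longlonglongrightarrow> l"
  shows "x \<longlonglongrightarrow> l"
proof (rule ccontr)
  assume "\<not> x \<longlonglongrightarrow> l"
  then obtain e where "0 < e" and "\<not> (\<forall>\<^sub>F n in sequentially. dist (x n) l < e)"
    by (auto simp: tendsto_iff)
  then have "infinite {n. e \<le> dist (x n) l}"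
    by (simp add: infinite_nat_iff_unbounded_le eventually_sequentially not_less)
  then obtain r where r: "strict_mono (r :: nat \<Rightarrow> nat)" and far: "\<And>n. e \<le> dist (x (r n)) l"
    using infinite_enumerate by (metis mem_Collect_eq)
  obtain s where "(x \<circ> r \<circ> s) \<longlonglongrightarrow> l"
    using assms[OF r] by blast
  then have "\<forall>\<^sub>F n in sequentially. dist ((x \<circ> r \<circ> s) n) l < e"
    using \<open>0 < e\<close> by (rule tendstoD)
  then show False
    using far by (auto simp: eventually_sequentially not_less[symmetric])
qed

theorem theorem3p12:
  fixes T :: "'a::real_normed_vector \<Rightarrow> 'b::real_normed_vector"
    and D :: "'a set"
    and W J :: "'a \<Rightarrow> real"
    and Jn :: "nat \<Rightarrow> 'a \<Rightarrow> real"
    and xbar :: 'a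
    and x :: "nat \<Rightarrow> 'a"
  assumes "bounded_linear T"
    and "\<exists>\<gamma>\<ge>0. \<forall>z\<in>D. W z \<ge> - \<gamma>"
    and "\<And>u. TW_bounded T W D u \<Longrightarrow>
           \<exists>l\<in>D. \<exists>r::nat \<Rightarrow> nat. strict_mono r \<and> (u \<circ> r) \<longlonglongrightarrow> l"
    and "TW_subseq_lsc T W D J"
    and "TW_coercive T W D Jn"
    and "TW_unif_consistent T W D Jn J"
    and "is_arg_min J (\<lambda>z. z \<in> D) xbar"
    and "\<And>z. is_arg_min J (\<lambda>z. z \<in> D) z \<Longrightarrow> z = xbar"
    and "\<And>n. n \<ge> 1 \<Longrightarrow> is_arg_min (Jn n) (\<lambda>z. z \<in> D) (x n)"
  shows "x \<longlonglongrightarrow> xbar"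
proof -
  obtain \<gamma> where W: "\<And>z. z \<in> D \<Longrightarrow> - \<gamma> \<le> W z"
    using assms(2) by blast
  have xbar: "xbar \<in> D" "\<And>z. z \<in> D \<Longrightarrow> J xbar \<le> J z"
    using assms(7) by (auto simp: is_arg_min_linorder)
  have unique: "z = xbar" if "z \<in> D" "J z \<le> J xbar" for z
    using assms(8)[of z] that xbar(2) by (auto simp: is_arg_min_linorder intro: order_trans)
  have "x n \<in> D \<and> Jn n (x n) \<le> Jn n xbar" if "n \<ge> 1" for n
    using assms(9)[OF that] xbar(1) by (simp add: is_arg_min_linorder)
  then have min: "\<forall>\<^sub>F n in sequentially. x n \<in> D \<and> Jn n (x n) \<le> Jn n xbar"
    unfolding eventually_sequentially by blast
  obtain c where c: "\<forall>\<^sub>F n in sequentially. norm (T (x n)) + W (x n) \<le> c"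
    using minimizers_gauge_bounded[OF assms(5,6) xbar(1) min] by blast
  have minimizing: "\<forall>\<^sub>F n in sequentially. J (x n) \<le> J xbar + \<epsilon>" if "0 < \<epsilon>" for \<epsilon>
    using minimizers_are_minimizing[OF assms(6) xbar(1) W min c that] .
  obtain N where N: "\<And>n. n \<ge> N \<Longrightarrow> x n \<in> D \<and> norm (T (x n)) + W (x n) \<le> c"
    using eventually_conj[OF min c] unfolding eventually_sequentially by blast
  show ?thesis
  proof (rule LIMSEQ_if_subseqs_LIMSEQ)
    fix r :: "nat \<Rightarrow> nat" assume r: "strict_mono r"
    \<comment> \<open>Only from index \<open>N\<close> on are membership in \<open>D\<close> and the bound on the gauge guaranteed.\<close>
    define q where "q k = r (k + N)" for k
    have q: "strict_mono q"
      using r by (simp add: q_def strict_mono_def)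
    have "q k \<ge> N" for k
      using seq_suble[OF r, of "k + N"] by (simp add: q_def)
    then have qN: "x (q k) \<in> D" "norm (T (x (q k))) + W (x (q k)) \<le> c" for k
      using N by auto
    have "norm (T (x (q k))) + W (x (q k)) \<in> {- \<gamma>..c}" for k
      using qN[of k] W[of "x (q k)"] norm_ge_zero[of "T (x (q k))"]
      unfolding atLeastAtMost_iff by linarith
    then have "bounded (range (\<lambda>k. norm (T (x (q k))) + W (x (q k))))"
      by (intro bounded_subset[OF bounded_closed_interval]) blast
    then have "TW_bounded T W D (x \<circ> q)"
      using qN(1) by (auto simp: TW_bounded_def)
    moreover have "\<forall>\<^sub>F k in sequentially. J ((x \<circ> q) k) \<le> J xbar + \<epsilon>" if "0 < \<epsilon>" for \<epsilon>
      using eventually_subseq[OF q minimizing[OF that]] by simp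
    ultimately obtain s where "strict_mono (s :: nat \<Rightarrow> nat)" "(x \<circ> q \<circ> s) \<longlonglongrightarrow> xbar"
      using TW_bounded_minimizing_subseq[OF assms(3,4) unique] by blast
    then show "\<exists>s::nat \<Rightarrow> nat. strict_mono s \<and> (x \<circ> r \<circ> s) \<longlonglongrightarrow> xbar"
      by (intro exI[of _ "\<lambda>k. s k + N"]) (simp add: q_def o_def strict_mono_def)
  qed
qed

end
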